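(* Suppose that $f_0$ belongs to the family of Gaussian densities and that $h_0=h$ (so that the pre-trained model is the Gaussian density $f(\cdot|h(x,\eta_0),\nu_0)$ with the same expert function as the prompt). For $G=(\beta,\tau,\eta,\nu)$ write $(\Delta\eta,\Delta\nu)=(\eta-\eta_0,\nu-\nu_0)$. Then the minimax lower bounds $$\inf_{\overline G_n}\ \sup_{G\in\Xi(l_n)}\ \mathbb E_{p_{G,n}}\Big[\|(\Delta\eta,\Delta\nu)\|^4\,|\exp(\overline\tau_n)-\exp(\tau)|^2\Big]\gtrsim n^{-1/r},$$ $$\inf_{\overline G_n}\ \sup_{G\in\Xi(l_n)}\ \mathbb E_{p_{G,n}}\Big[\exp^2(\tau)\,\|(\Delta\eta,\Delta\nu)\|^2\,\|(\overline\beta_n,\overline\eta_n,\overline\nu_n)-(\beta,\eta,\nu)\|^2\Big]\gtrsim n^{-1/r}$$ hold for any sequence $(l_n)_{n\ge1}$ and any $0<r<1$, where the infimum is over all estimators $\overline G_n=(\overline\beta_n,\overline\tau_n,\overline\eta_n,\overline\nu_n)$ (measurable functions of the data) taking values in $\Xi$, and $$\Xi(l_n)=\Big\{G=(\beta,\tau,\eta,\nu)\in\Xi:\ \frac{l_n}{\min_{1\le i\le q,\,1\le j\le d}\{|\eta^{(i)}|^2,|\nu|^2,|\beta^{(j)}|^2\}\sqrt n}\le\exp(\tau)\Big\}.$$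
   Context: Model. $\mathcal X\subset\mathbb R^d$ is bounded, $\mathcal Y\subset\mathbb R$. The covariates $X_1,\dots,X_n$ are i.i.d. from a known continuous probability distribution on $\mathcal X$; $\mathbb E_X$ denotes expectation with respect to this distribution. Parameters are $G=(\beta,\tau,\eta,\nu)\in\Xi$, where $\Xi\subseteq\mathbb R^d\times\mathbb R\times\mathbb R^q\times\mathbb R_+$ ($\mathbb{R}_+$: positive reals) is compact. The softmax-contaminated mixture of experts has conditional density $$p_G(y|x)=\frac{1}{1+\exp(\beta^\top x+\tau)}\,f_0(y|h_0(x,\eta_0),\nu_0)+\frac{\exp(\beta^\top x+\tau)}{1+\exp(\beta^\top x+\tau)}\,f(y|h(x,\eta),\nu).$$ Here $f_0(\cdot|h_0(\cdot,\eta_0),\nu_0)$ (the pre-trained model) is a fixed, known conditional density with mean expert function $x\mapsto h_0(x,\eta_0)\in\mathbb R$ and variance $\nu_0$; $f(\cdot|\mu,\nu)$ (the prompt model) is the univariate Gaussian density with mean $\mu$ and variance $\nu$; the real-valued prompt expert $h(x,\eta)$ is differentiable in $\eta\in\mathbb R^q$ for almost all $x\in\mathcal X$. Data. For $G\in\Xi$, $\mathbb E_{p_{G,n}}$ is the expectation under $n$ i.i.d. pairs $(X_i,Y_i)$ with $Y_i|X_i\sim p_{G}(\cdot|X_i)$. Standing tail assumption. $f_0$ is bounded and, for some $p>0$, $\mathbb E_X[-\log f_0(y|h_0(X,\eta_0),\nu_0)]\gtrsim |y|^p$ for almost every $y\in\mathcal Y$. Notation. Superscripts $(i)$ denote coordinates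 of vectors. $\|\cdot\|$ is the Euclidean norm. $a_n\gtrsim b_n$ means $a_n\ge c\,b_n$ for all $n$ with a constant $c>0$ not depending on $n$.
   Formalization: For arbitrary compact Ξ and arbitrary l_n the claim fails (Ξ a single point, or l_n = n, which empties Ξ(l_n)); it is proved assuming that from some index N on the sets Ξ(l_n) share a common nonempty open set, and the bounds are for all n ≥ N. *)

theory Defs
  imports "HOL-Probability.Probability"
begin

text \<open>Parameters \<open>G = (\<beta>, \<tau>, \<eta>, \<nu>)\<close>; the last component is a variance, not a standard deviation.\<close>

type_synonym ('d, 'q) param = "(real ^ 'd) \<times> real \<times> (real ^ 'q) \<times> real"

text \<open>Mean \<open>\<mu>\<close> and variance \<open>\<nu>\<close>; the library's \<^const>\<open>normal_density\<close> takes the standard deviation.\<close>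

definition gaussian_pdf :: "real \<Rightarrow> real \<Rightarrow> real \<Rightarrow> real" where
  "gaussian_pdf y \<mu> \<nu> = normal_density \<mu> (sqrt \<nu>) y"

text \<open>The conditional density \<open>p\<^sub>G(y | x)\<close>. Densities are written \<open>f y \<mu> \<nu>\<close> for \<open>f(y | \<mu>, \<nu>)\<close>.\<close>

definition cmoe_density ::
  "(real \<Rightarrow> real \<Rightarrow> real \<Rightarrow> real) \<Rightarrow> (real ^ 'd::finite \<Rightarrow> real ^ 'q \<Rightarrow> real) \<Rightarrow> real ^ 'q \<Rightarrow> real \<Rightarrow>
   (real ^ 'd \<Rightarrow> real ^ 'q \<Rightarrow> real) \<Rightarrow> ('d, 'q) param \<Rightarrow> real ^ 'd \<Rightarrow> real \<Rightarrow> real" where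
  "cmoe_density f0 h0 \<eta>0 \<nu>0 h G x y =
     (case G of (\<beta>, \<tau>, \<eta>, \<nu>) \<Rightarrow>
        1 / (1 + exp (\<beta> \<bullet> x + \<tau>)) * f0 y (h0 x \<eta>0) \<nu>0
      + exp (\<beta> \<bullet> x + \<tau>) / (1 + exp (\<beta> \<bullet> x + \<tau>)) * gaussian_pdf y (h x \<eta>) \<nu>)"

text \<open>Law of \<open>n\<close> i.i.d. pairs with covariate law \<open>PX\<close> and conditional Lebesgue density \<open>p x\<close>.\<close>

definition data_dist ::
  "nat \<Rightarrow> (real ^ 'd::finite) measure \<Rightarrow> (real ^ 'd \<Rightarrow> real \<Rightarrow> real) \<Rightarrow> (nat \<Rightarrow> (real ^ 'd) \<times> real) measure" where
  "data_dist n PX p =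
     PiM {..<n} (\<lambda>_. density (PX \<Otimes>\<^sub>M lborel) (\<lambda>(x, y). ennreal (p x y)))"

definition estimators ::
  "nat \<Rightarrow> ('d::finite, 'q::finite) param set \<Rightarrow> ((nat \<Rightarrow> (real ^ 'd) \<times> real) \<Rightarrow> ('d, 'q) param) set" where
  "estimators n \<Xi> = measurable (PiM {..<n} (\<lambda>_. borel)) (restrict_space borel \<Xi>)"

text \<open>\<open>L T G\<close> is the (nonnegative) loss of the estimate \<open>T\<close> when \<open>G\<close> is the true parameter, and
  \<open>P G\<close> is the law of the \<open>n\<close> observations under \<open>G\<close>.\<close>

definition minimax_risk ::
  "nat \<Rightarrow> ('d::finite, 'q::finite) param set \<Rightarrow> ('d, 'q) param set \<Rightarrow>
   (('d, 'q) param \<Rightarrow> (nat \<Rightarrow> (real ^ 'd) \<times> real) measure) \<Rightarrow>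
   (('d, 'q) param \<Rightarrow> ('d, 'q) param \<Rightarrow> real) \<Rightarrow> ennreal" where
  "minimax_risk n \<Xi> \<Theta> P L =
     (INF T \<in> estimators n \<Xi>. SUP G \<in> \<Theta>. \<integral>\<^sup>+ \<omega>. ennreal (L (T \<omega>) G) \<partial>P G)"

text \<open>The set \<open>\<Xi>(l\<^sub>n)\<close>, with \<open>l\<close> the value \<open>l\<^sub>n\<close>. The quotient is taken in the extended reals, so that a
  vanishing minimum makes it infinite when \<open>l > 0\<close> (real division would make it \<open>0\<close>).\<close>

definition Xi_trunc :: "('d::finite, 'q::finite) param set \<Rightarrow> real \<Rightarrow> nat \<Rightarrow> ('d, 'q) param set" where
  "Xi_trunc \<Xi> l n =
     {(\<beta>, \<tau>, \<eta>, \<nu>). (\<beta>, \<tau>, \<eta>, \<nu>) \<in> \<Xi> \<and>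
        ereal l / ereal (Min (range (\<lambda>i. \<bar>\<eta> $ i\<bar>\<^sup>2) \<union> {\<bar>\<nu>\<bar>\<^sup>2} \<union> range (\<lambda>j. \<bar>\<beta> $ j\<bar>\<^sup>2)) * sqrt (real n))
          \<le> ereal (exp \<tau>)}"

text \<open>Expectation with values in the extended reals: unlike the Bochner integral it does not collapse
  to \<open>0\<close> for a function that is bounded below but not integrable.\<close>

definition ext_expectation :: "'a measure \<Rightarrow> ('a \<Rightarrow> real) \<Rightarrow> ereal" where
  "ext_expectation M g =
     enn2ereal (\<integral>\<^sup>+ x. ennreal (g x) \<partial>M) - enn2ereal (\<integral>\<^sup>+ x. ennreal (- g x) \<partial>M)"

definition loss_tau :: "real ^ 'q::finite \<Rightarrow> real \<Rightarrow> ('d::finite, 'q) param \<Rightarrow> ('d, 'q) param \<Rightarrow> real" where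
  "loss_tau \<eta>0 \<nu>0 T G =
     (case (T, G) of ((\<beta>', \<tau>', \<eta>', \<nu>'), (\<beta>, \<tau>, \<eta>, \<nu>)) \<Rightarrow>
        norm (\<eta> - \<eta>0, \<nu> - \<nu>0) ^ 4 * \<bar>exp \<tau>' - exp \<tau>\<bar>\<^sup>2)"

definition loss_expert :: "real ^ 'q::finite \<Rightarrow> real \<Rightarrow> ('d::finite, 'q) param \<Rightarrow> ('d, 'q) param \<Rightarrow> real" where
  "loss_expert \<eta>0 \<nu>0 T G =
     (case (T, G) of ((\<beta>', \<tau>', \<eta>', \<nu>'), (\<beta>, \<tau>, \<eta>, \<nu>)) \<Rightarrow>
        (exp \<tau>)\<^sup>2 * (norm (\<eta> - \<eta>0, \<nu> - \<nu>0))\<^sup>2 * (norm ((\<beta>', \<eta>', \<nu>') - (\<beta>, \<eta>, \<nu>)))\<^sup>2)"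

end

theory Submission
  imports Defs
begin

text \<open>
  Le Cam's two-point method. Inside the interior of the truncated sets fix a parameter with
  \<open>(\<eta>, \<nu>) \<noteq> (\<eta>0, \<nu>0)\<close> and move only the gate, by \<open>\<delta> \<sim> n\<^sup>-\<^sup>1\<^sup>/\<^sup>2\<close>: perturb \<open>\<tau>\<close> for the
  first bound and \<open>\<beta>\<close> for the second. Since the covariates are bounded, both mixture weights, hence the
  density, change at most by a factor \<open>exp \<delta>\<close>, so the \<open>\<chi>\<^sup>2\<close>-distance of one observation is at most
  \<open>4\<delta>\<^sup>2\<close> and that of \<open>n\<close> observations stays at most \<open>1\<close>. The risk is then at least of order \<open>\<delta>\<^sup>2 \<sim> 1/n\<close>,
  which dominates \<open>n\<^sup>-\<^sup>1\<^sup>/\<^sup>r\<close> because \<open>r < 1\<close>.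
\<close>

section \<open>Product densities and Le Cam's inequality for i.i.d. samples\<close>

text \<open>A product measure is determined by its values on boxes \<open>Pi\<^sub>E I A\<close>,
  and there the integral of the product density factorises by Fubini. This identifies the likelihood
  ratio of a sample as the product of the ratios of the single observations.\<close>

lemma PiM_density:
  assumes "finite I" "prob_space M" "prob_space (density M g)"
    and g[measurable]: "g \<in> borel_measurable M"
  shows "PiM I (\<lambda>_. density M g) = density (PiM I (\<lambda>_. M)) (\<lambda>\<omega>. \<Prod>i\<in>I. g (\<omega> i))"
proof -
  interpret M: product_sigma_finite "\<lambda>_. M"
    by (simp add: assms(2) product_sigma_finite_def prob_space_imp_sigma_finite)
  interpret N: product_sigma_finite "\<lambda>_. density M g"
    by (simp add: assms(3) product_sigma_finite_def prob_space_imp_sigma_finite)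
  have "density (PiM I (\<lambda>_. M)) (\<lambda>\<omega>. \<Prod>i\<in>I. g (\<omega> i)) = PiM I (\<lambda>_. density M g)"
  proof (rule N.PiM_eqI)
    show "finite I" by fact
    show "sets (density (PiM I (\<lambda>_. M)) (\<lambda>\<omega>. \<Prod>i\<in>I. g (\<omega> i))) = sets (PiM I (\<lambda>_. density M g))"
      by (simp cong: sets_PiM_cong)
  next
    fix A assume "\<And>i. i \<in> I \<Longrightarrow> A i \<in> sets (density M g)"
    then have A[measurable]: "\<And>i. i \<in> I \<Longrightarrow> A i \<in> sets M" by simp
    have [measurable]: "Pi\<^sub>E I A \<in> sets (PiM I (\<lambda>_. M))"
      using A \<open>finite I\<close> by (intro sets_PiM_I_finite) auto
    have "emeasure (density (PiM I (\<lambda>_. M)) (\<lambda>\<omega>. \<Prod>i\<in>I. g (\<omega> i))) (Pi\<^sub>E I A)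
        = (\<integral>\<^sup>+ \<omega>. (\<Prod>i\<in>I. g (\<omega> i)) * indicator (Pi\<^sub>E I A) \<omega> \<partial>PiM I (\<lambda>_. M))"
      by (intro emeasure_density) measurable
    also have "\<dots> = (\<integral>\<^sup>+ \<omega>. (\<Prod>i\<in>I. g (\<omega> i) * indicator (A i) (\<omega> i)) \<partial>PiM I (\<lambda>_. M))"
    proof (rule nn_integral_cong)
      fix \<omega> assume "\<omega> \<in> space (PiM I (\<lambda>_. M))"
      then have "indicator (Pi\<^sub>E I A) \<omega> = (\<Prod>i\<in>I. indicator (A i) (\<omega> i) :: ennreal)"
        using \<open>finite I\<close> by (auto simp: indicator_def space_PiM PiE_iff prod_zero_iff)
      then show "(\<Prod>i\<in>I. g (\<omega> i)) * indicator (Pi\<^sub>E I A) \<omega> = (\<Prod>i\<in>I. g (\<omega> i) * indicator (A i) (\<omega> i))"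
        by (simp add: prod.distrib)
    qed
    also have "\<dots> = (\<Prod>i\<in>I. \<integral>\<^sup>+ x. g x * indicator (A i) x \<partial>M)"
      using \<open>finite I\<close> A by (intro M.product_nn_integral_prod) auto
    also have "\<dots> = (\<Prod>i\<in>I. emeasure (density M g) (A i))"
      by (intro prod.cong refl emeasure_density[symmetric]) auto
    finally show "emeasure (density (PiM I (\<lambda>_. M)) (\<lambda>\<omega>. \<Prod>i\<in>I. g (\<omega> i))) (Pi\<^sub>E I A)
        = (\<Prod>i\<in>I. emeasure (density M g) (A i))" .
  qed
  then show ?thesis ..
qed

text \<open>Here \<open>w\<close> is the likelihood ratio of a second law \<open>density P w\<close>
  with respect to \<open>P\<close>, while \<open>A\<close> and \<open>B\<close> are the losses at
  the two points. The common part of the two laws has density \<open>min 1 w\<close>, and on it the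
  summed loss is at least \<open>D\<close>. A second moment of at most 2, that is, a chi-squared
  distance of at most 1, forces this common part to have mass at least 1/2.\<close>

lemma le_cam_two_point:
  fixes w :: "'a \<Rightarrow> real"
  assumes w[measurable]: "w \<in> borel_measurable P" and w0: "\<And>x. 0 \<le> w x"
    and one: "(\<integral>\<^sup>+ x. ennreal (w x) \<partial>P) = 1"
    and two: "(\<integral>\<^sup>+ x. ennreal ((w x)\<^sup>2) \<partial>P) \<le> 2"
    and [measurable]: "A \<in> borel_measurable P" "B \<in> borel_measurable P"
    and D: "\<And>x. ennreal D \<le> A x + B x" and D0: "0 \<le> D"
  shows "ennreal (D / 2) \<le> (\<integral>\<^sup>+ x. A x \<partial>P) + (\<integral>\<^sup>+ x. B x \<partial>density P w)"
proof -
  let ?m = "\<integral>\<^sup>+ x. ennreal (min 1 (w x)) \<partial>P"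
  \<comment> \<open>\<open>w - w\<^sup>2/4 \<le> 1\<close> is \<open>(w/2 - 1)\<^sup>2 \<ge> 0\<close>\<close>
  have key: "w x \<le> min 1 (w x) + (w x)\<^sup>2 / 4" for x
    using zero_le_power2[of "w x / 2 - 1"] by (simp add: power2_eq_square field_simps min_def)
  \<comment> \<open>Integrating \<open>key\<close> against \<open>P\<close> gives 1 \<le>
    \<open>?m\<close> + 2/4.\<close>
  have "1 \<le> (\<integral>\<^sup>+ x. ennreal (min 1 (w x)) + ennreal (1/4) * ennreal ((w x)\<^sup>2) \<partial>P)"
    unfolding one[symmetric]
  proof (intro nn_integral_mono)
    fix x
    have "ennreal (w x) \<le> ennreal (min 1 (w x) + 1/4 * (w x)\<^sup>2)"
      using key[of x] by (intro ennreal_leI) simp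
    also have "\<dots> = ennreal (min 1 (w x)) + ennreal (1/4) * ennreal ((w x)\<^sup>2)"
      using w0[of x] by (subst ennreal_plus) (auto simp: ennreal_mult[symmetric])
    finally show "ennreal (w x) \<le> ennreal (min 1 (w x)) + ennreal (1/4) * ennreal ((w x)\<^sup>2)" .
  qed
  also have "\<dots> = ?m + ennreal (1/4) * (\<integral>\<^sup>+ x. ennreal ((w x)\<^sup>2) \<partial>P)"
    by (simp add: nn_integral_add nn_integral_cmult)
  also have "\<dots> \<le> ?m + ennreal (1/4) * 2"
    by (intro add_left_mono mult_left_mono two) simp
  also have "ennreal (1/4) * 2 = ennreal (1/2)"
    by (simp add: ennreal_mult'[symmetric] flip: ennreal_numeral)
  finally have "1 \<le> ?m + ennreal (1/2)" .
  \<comment> \<open>Cancelling 1/2 in the extended nonnegative reals goes through a finite value of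
    \<open>?m\<close>; an infinite value satisfies the claim at once.\<close>
  then have half: "ennreal (1/2) \<le> ?m"
  proof (cases ?m)
    case (real r)
    then have "ennreal 1 \<le> ennreal (r + 1/2)"
      using \<open>1 \<le> ?m + ennreal (1/2)\<close> by (subst ennreal_plus) auto
    then have "1 / 2 \<le> r"
      using real by (subst (asm) ennreal_le_iff) auto
    from ennreal_leI[OF this] show ?thesis
      using real by simp
  qed simp
  have "ennreal (D / 2) = ennreal D * ennreal (1/2)"
    using D0 by (simp add: ennreal_mult'[symmetric] del: ennreal_half)
  also have "\<dots> \<le> ennreal D * ?m"
    by (intro mult_left_mono half) simp
  also have "\<dots> = (\<integral>\<^sup>+ x. ennreal D * ennreal (min 1 (w x)) \<partial>P)"
    by (simp add: nn_integral_cmult)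
  also have "\<dots> \<le> (\<integral>\<^sup>+ x. A x + ennreal (w x) * B x \<partial>P)"
  proof (intro nn_integral_mono)
    fix x
    have "ennreal D * ennreal (min 1 (w x)) \<le> (A x + B x) * ennreal (min 1 (w x))"
      by (intro mult_right_mono D) simp
    also have "\<dots> = ennreal (min 1 (w x)) * A x + ennreal (min 1 (w x)) * B x"
      by (simp add: distrib_left mult.commute)
    \<comment> \<open>The minimum is bounded by 1 in front of \<open>A\<close> and by
      \<open>w x\<close> in front of \<open>B\<close>; the latter factor turns \<open>P\<close> into
      the second law.\<close>
    also have "\<dots> \<le> 1 * A x + ennreal (w x) * B x"
      by (intro add_mono mult_right_mono) (auto simp: ennreal_leI simp flip: ennreal_1)
    finally show "ennreal D * ennreal (min 1 (w x)) \<le> A x + ennreal (w x) * B x" by simp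
  qed
  also have "\<dots> = (\<integral>\<^sup>+ x. A x \<partial>P) + (\<integral>\<^sup>+ x. B x \<partial>density P w)"
    by (simp add: nn_integral_add nn_integral_density)
  finally show ?thesis .
qed

text \<open>Expanding the square, the integral of (g - 1)^2 is that of g^2 minus 1, because
  \<open>g\<close> integrates to 1. So a pointwise bound on (g - 1)^2 bounds the chi-squared
  distance.\<close>

lemma second_moment_le:
  assumes "prob_space P"
    and g[measurable]: "g \<in> borel_measurable P" and g0: "\<And>x. 0 \<le> g x"
    and one: "(\<integral>\<^sup>+ x. ennreal (g x) \<partial>P) = 1"
    and K: "AE x in P. (g x - 1)\<^sup>2 \<le> K" and K0: "0 \<le> K"
  shows "(\<integral>\<^sup>+ x. ennreal ((g x)\<^sup>2) \<partial>P) \<le> ennreal (1 + K)"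
proof -
  interpret prob_space P by fact
  \<comment> \<open>Adding 1 lets the expansion be used as g^2 + 1 \<le> 2 g + K, with no
    subtraction in \<open>ennreal\<close>; the finite 1 cancels at the end.\<close>
  have "(\<integral>\<^sup>+ x. ennreal ((g x)\<^sup>2) \<partial>P) + 1 = (\<integral>\<^sup>+ x. ennreal ((g x)\<^sup>2) + 1 \<partial>P)"
    by (simp add: nn_integral_add emeasure_space_1)
  also have "\<dots> \<le> (\<integral>\<^sup>+ x. ennreal 2 * ennreal (g x) + ennreal K \<partial>P)"
  proof (rule nn_integral_mono_AE, use K in eventually_elim)
    fix x assume "(g x - 1)\<^sup>2 \<le> K"
    then have "ennreal ((g x)\<^sup>2 + 1) \<le> ennreal (2 * g x + K)"
      by (intro ennreal_leI) (simp add: power2_eq_square algebra_simps)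
    then show "ennreal ((g x)\<^sup>2) + 1 \<le> ennreal 2 * ennreal (g x) + ennreal K"
      using g0[of x] K0 by (simp add: ennreal_plus ennreal_mult)
  qed
  also have "\<dots> = ennreal 2 * 1 + ennreal K"
    by (subst nn_integral_add) (simp_all add: nn_integral_cmult one emeasure_space_1)
  also have "\<dots> = ennreal (2 + K)"
    using K0 by simp
  also have "\<dots> = ennreal (1 + K) + ennreal 1"
    using K0 by (subst ennreal_plus[symmetric]) auto
  finally show ?thesis
    by (simp add: add.commute)
qed

text \<open>The second moment of the likelihood ratio tensorises: for \<open>n\<close> observations
  it is the n-th power of that for one, hence at most (1 + K)^n \<le> exp (n K) \<le> exp (1/2)
  \<le> 2. The condition \<open>nK\<close> is exactly what keeps this within the budget of
  \<open>le_cam_two_point\<close>.\<close>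

lemma le_cam_iid:
  fixes g :: "'a \<Rightarrow> real"
  assumes P: "prob_space P"
    and g[measurable]: "g \<in> borel_measurable P" and g0: "\<And>x. 0 \<le> g x"
    and Q: "prob_space (density P g)"
    and K: "AE x in P. (g x - 1)\<^sup>2 \<le> K" and K0: "0 \<le> K" and nK: "real n * K \<le> 1 / 2"
    and [measurable]: "A \<in> borel_measurable (PiM {..<n} (\<lambda>_. P))" "B \<in> borel_measurable (PiM {..<n} (\<lambda>_. P))"
    and D: "\<And>\<omega>. ennreal D \<le> A \<omega> + B \<omega>" and D0: "0 \<le> D"
  shows "ennreal (D / 2) \<le> (\<integral>\<^sup>+ \<omega>. A \<omega> \<partial>PiM {..<n} (\<lambda>_. P)) + (\<integral>\<^sup>+ \<omega>. B \<omega> \<partial>PiM {..<n} (\<lambda>_. density P g))"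
proof -
  interpret product_sigma_finite "\<lambda>_. P"
    by (simp add: P product_sigma_finite_def prob_space_imp_sigma_finite)
  \<comment> \<open>The integral of \<open>g\<close> is the total mass of the probability measure
    \<open>density P g\<close>.\<close>
  have one: "(\<integral>\<^sup>+ x. ennreal (g x) \<partial>P) = 1"
    using prob_space.emeasure_space_1[OF Q] by (simp add: emeasure_density cong: nn_integral_cong)
  define w where "w = (\<lambda>\<omega>. \<Prod>i<n. g (\<omega> i))"
  have w: "ennreal (w \<omega>) = (\<Prod>i<n. ennreal (g (\<omega> i)))" for \<omega>
    using g0 by (simp add: w_def prod_ennreal)
  have w2: "ennreal ((w \<omega>)\<^sup>2) = (\<Prod>i<n. ennreal ((g (\<omega> i))\<^sup>2))" for \<omega>
    by (simp add: w_def prod_ennreal flip: prod_power_distrib)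
  have "(\<integral>\<^sup>+ \<omega>. ennreal ((w \<omega>)\<^sup>2) \<partial>PiM {..<n} (\<lambda>_. P)) = (\<integral>\<^sup>+ x. ennreal ((g x)\<^sup>2) \<partial>P) ^ n"
    unfolding w2 by (subst product_nn_integral_prod) auto
  also have "\<dots> \<le> ennreal (1 + K) ^ n"
    by (intro power_mono second_moment_le P g g0 one K K0) simp
  also have "\<dots> = ennreal ((1 + K) ^ n)"
    using K0 by (intro ennreal_power) simp
  also have "\<dots> \<le> ennreal 2"
  proof (rule ennreal_leI)
    have "(1 + K) ^ n \<le> exp K ^ n"
      using K0 by (intro power_mono) auto
    also have "\<dots> = exp (real n * K)"
      by (simp add: exp_of_nat_mult)
    also have "\<dots> \<le> exp (1/2)"
      using nK by simp
    also have "\<dots> \<le> 2"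
      using exp_bound[of "1/2"] by (simp add: power2_eq_square)
    finally show "(1 + K) ^ n \<le> 2" .
  qed
  finally have two: "(\<integral>\<^sup>+ \<omega>. ennreal ((w \<omega>)\<^sup>2) \<partial>PiM {..<n} (\<lambda>_. P)) \<le> 2" by simp
  have "(\<integral>\<^sup>+ \<omega>. ennreal (w \<omega>) \<partial>PiM {..<n} (\<lambda>_. P)) = 1"
    unfolding w by (subst product_nn_integral_prod) (auto simp: one)
  moreover have "PiM {..<n} (\<lambda>_. density P g) = density (PiM {..<n} (\<lambda>_. P)) w"
    unfolding w by (intro PiM_density P Q) auto
  moreover have "w \<in> borel_measurable (PiM {..<n} (\<lambda>_. P))"
    unfolding w_def by measurable
  moreover have "0 \<le> w \<omega>" for \<omega>
    unfolding w_def by (intro prod_nonneg) (simp add: g0)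
  ultimately show ?thesis
    using le_cam_two_point[of w _ A B D] two D D0 by simp
qed

section \<open>The mixture density: positivity, sensitivity to the gate, normalisation\<close>

lemma gaussian_pdf_pos: "0 < \<nu> \<Longrightarrow> 0 < gaussian_pdf y \<mu> \<nu>"
  unfolding gaussian_pdf_def by (intro normal_density_pos) simp

lemma nn_integral_gaussian_pdf:
  assumes "0 < \<nu>"
  shows "(\<integral>\<^sup>+ y. ennreal (gaussian_pdf y \<mu> \<nu>) \<partial>lborel) = 1"
  using prob_space.emeasure_space_1[OF prob_space_normal_density, of "sqrt \<nu>" \<mu>] assms
  by (simp add: gaussian_pdf_def emeasure_density cong: nn_integral_cong)

lemma cmoe_density_pos:
  assumes "0 < \<nu>0" "0 < \<nu>"
  shows "0 < cmoe_density gaussian_pdf h \<eta>0 \<nu>0 h (\<beta>, \<tau>, \<eta>, \<nu>) x y"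
  unfolding cmoe_density_def using assms
  by (auto intro!: add_pos_pos mult_pos_pos divide_pos_pos gaussian_pdf_pos)

text \<open>The two parameters share both experts and differ only in the logit of the gate. Each of
  the two mixture weights changes by at most the factor exp \<delta>, so their combination with
  fixed nonnegative densities does too.\<close>

lemma cmoe_density_ratio:
  assumes "0 < \<nu>0" "0 < \<nu>" and d: "\<bar>(\<beta>2 \<bullet> x + \<tau>2) - (\<beta>1 \<bullet> x + \<tau>1)\<bar> \<le> \<delta>"
  shows "cmoe_density gaussian_pdf h \<eta>0 \<nu>0 h (\<beta>2, \<tau>2, \<eta>, \<nu>) x y
    \<le> exp \<delta> * cmoe_density gaussian_pdf h \<eta>0 \<nu>0 h (\<beta>1, \<tau>1, \<eta>, \<nu>) x y"
proof -
  \<comment> \<open>\<open>s\<close> and \<open>t\<close> play the role of the two logits; the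
    claims concern the weights of the pre-trained model and of the prompt.\<close>
  have odds: "1 / (1 + exp s) \<le> exp \<delta> * (1 / (1 + exp t))"
    "exp s / (1 + exp s) \<le> exp \<delta> * (exp t / (1 + exp t))" if "\<bar>s - t\<bar> \<le> \<delta>" for s t :: real
  proof -
    have le: "exp s \<le> exp \<delta> * exp t" "exp t \<le> exp \<delta> * exp s" "1 \<le> exp \<delta>"
      using that by (auto simp flip: exp_add)
    have "0 < 1 + exp s" "0 < 1 + exp t"
      by (auto intro: add_pos_pos)
    moreover have "1 + exp t \<le> exp \<delta> * (1 + exp s)"
      using le by (subst distrib_left) linarith
    \<comment> \<open>After cross-multiplication the term \<open>exp s * exp t\<close> stands on
      both sides, so a single factor exp \<delta> suffices; bounding numerator and denominator
      separately would give exp (2 \<delta>).\<close>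
    moreover have "exp s * (1 + exp t) \<le> exp \<delta> * exp t * (1 + exp s)"
    proof -
      have "exp s * (1 + exp t) = exp s + 1 * (exp s * exp t)"
        by (simp add: algebra_simps)
      also have "\<dots> \<le> exp \<delta> * exp t + exp \<delta> * (exp s * exp t)"
        by (intro add_mono mult_right_mono le) simp
      finally show ?thesis
        by (simp add: algebra_simps)
    qed
    ultimately show "1 / (1 + exp s) \<le> exp \<delta> * (1 / (1 + exp t))"
      "exp s / (1 + exp s) \<le> exp \<delta> * (exp t / (1 + exp t))"
      by (simp_all add: divide_simps)
  qed
  show ?thesis
    using mult_right_mono[OF odds(1)[OF d], of "gaussian_pdf y (h x \<eta>0) \<nu>0"]
      mult_right_mono[OF odds(2)[OF d], of "gaussian_pdf y (h x \<eta>) \<nu>"]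
      gaussian_pdf_pos[OF assms(1), of y "h x \<eta>0"] gaussian_pdf_pos[OF assms(2), of y "h x \<eta>"]
    by (simp add: cmoe_density_def distrib_left mult.assoc)
qed

lemma measurable_cmoe_density:
  assumes PX: "sets PX = sets borel" and h: "\<And>\<eta>. (\<lambda>x. h x \<eta>) \<in> borel_measurable borel"
  shows "(\<lambda>(x, y). cmoe_density gaussian_pdf h \<eta>0 \<nu>0 h G x y) \<in> borel_measurable (PX \<Otimes>\<^sub>M lborel)"
proof -
  obtain \<beta> \<tau> \<eta> \<nu> where G: "G = (\<beta>, \<tau>, \<eta>, \<nu>)" by (cases G)
  have [measurable]: "(\<lambda>x. h x \<eta>) \<in> borel_measurable PX" "(\<lambda>x. b \<bullet> x) \<in> borel_measurable PX" for \<eta> b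
    using h[of \<eta>] by (simp_all cong: measurable_cong_sets add: PX)
  show ?thesis
    unfolding G cmoe_density_def gaussian_pdf_def normal_density_def prod.case by measurable
qed

lemma prob_space_cmoe:
  assumes "prob_space PX" and PX: "sets PX = sets borel"
    and h: "\<And>\<eta>. (\<lambda>x. h x \<eta>) \<in> borel_measurable borel" and \<nu>: "0 < \<nu>0" "0 < \<nu>"
  shows "prob_space (density (PX \<Otimes>\<^sub>M lborel)
    (\<lambda>(x, y). ennreal (cmoe_density gaussian_pdf h \<eta>0 \<nu>0 h (\<beta>, \<tau>, \<eta>, \<nu>) x y)))" (is "prob_space (density _ ?f)")
proof
  interpret PX: prob_space PX by fact
  interpret pair_sigma_finite PX "lborel :: real measure" ..
  have [measurable]: "(\<lambda>x. h x \<eta>) \<in> borel_measurable PX" for \<eta>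
    using h[of \<eta>] by (simp cong: measurable_cong_sets add: PX)
  have f[measurable]: "?f \<in> borel_measurable (PX \<Otimes>\<^sub>M lborel)"
    using measurable_cmoe_density[where h = h and PX = PX, OF PX h]
    by (simp add: split_beta')
  \<comment> \<open>For each fixed \<open>x\<close> both components integrate to 1 in
    \<open>y\<close>, and the gate weights add up to 1.\<close>
  have inner: "(\<integral>\<^sup>+ y. ?f (x, y) \<partial>lborel) = 1" for x
  proof -
    let ?t = "\<beta> \<bullet> x + \<tau>"
    have pos: "0 < 1 + exp ?t" by (intro add_pos_pos) auto
    have "?f (x, y) = ennreal (1 / (1 + exp ?t)) * ennreal (gaussian_pdf y (h x \<eta>0) \<nu>0)
        + ennreal (exp ?t / (1 + exp ?t)) * ennreal (gaussian_pdf y (h x \<eta>) \<nu>)" for y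
      using pos gaussian_pdf_pos[OF \<nu>(1), of y "h x \<eta>0"] gaussian_pdf_pos[OF \<nu>(2), of y "h x \<eta>"]
      by (simp add: cmoe_density_def ennreal_mult[symmetric] flip: ennreal_plus)
    moreover have [measurable]: "(\<lambda>y. gaussian_pdf y \<mu> v) \<in> borel_measurable borel" for \<mu> v
      unfolding gaussian_pdf_def by measurable
    ultimately have "(\<integral>\<^sup>+ y. ?f (x, y) \<partial>lborel) = ennreal (1 / (1 + exp ?t)) + ennreal (exp ?t / (1 + exp ?t))"
      by (simp add: nn_integral_add nn_integral_cmult nn_integral_gaussian_pdf \<nu>)
    also have "\<dots> = ennreal (1 / (1 + exp ?t) + exp ?t / (1 + exp ?t))"
      using pos by (intro ennreal_plus[symmetric]) auto
    also have "1 / (1 + exp ?t) + exp ?t / (1 + exp ?t) = 1"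
      using pos by (simp flip: add_divide_distrib)
    finally show ?thesis by simp
  qed
  have "emeasure (density (PX \<Otimes>\<^sub>M lborel) ?f) (space (density (PX \<Otimes>\<^sub>M lborel) ?f))
      = (\<integral>\<^sup>+ z. ?f z \<partial>(PX \<Otimes>\<^sub>M lborel))"
    unfolding space_density by (subst emeasure_density[OF f sets.top]) (auto intro!: nn_integral_cong)
  also have "\<dots> = (\<integral>\<^sup>+ x. \<integral>\<^sup>+ y. ?f (x, y) \<partial>lborel \<partial>PX)"
    by (rule lborel.nn_integral_fst[symmetric]) (rule f)
  also have "\<dots> = 1"
    unfolding inner by (simp add: PX.emeasure_space_1)
  finally show "emeasure (density (PX \<Otimes>\<^sub>M lborel) ?f) (space (density (PX \<Otimes>\<^sub>M lborel) ?f)) = 1" .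
qed

section \<open>Le Cam's bound for the minimax risk of the mixture model\<close>

text \<open>The worst-case risk dominates the average of the risks at the two points. This average
  halves the bound \<open>D / 2\<close> of \<open>le_cam_iid\<close>, which gives
  \<open>D / 4\<close>. Hypothesis \<open>D\<close> says that no single estimate is good at both
  points, while \<open>close\<close> makes the two laws hard to tell apart.\<close>

lemma minimax_risk_two_point:
  fixes PX :: "(real ^ 'd::finite) measure" and h :: "real ^ 'd \<Rightarrow> real ^ 'q::finite \<Rightarrow> real"
    and \<beta>1 \<beta>2 :: "real ^ 'd" and \<eta> :: "real ^ 'q"
  assumes prob: "prob_space PX" and PX: "sets PX = sets borel"
    and h: "\<And>\<eta>. (\<lambda>x. h x \<eta>) \<in> borel_measurable borel" and \<nu>: "0 < \<nu>0" "0 < \<nu>"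
    and close: "AE x in PX. \<bar>(\<beta>2 \<bullet> x + \<tau>2) - (\<beta>1 \<bullet> x + \<tau>1)\<bar> \<le> \<delta>"
    and \<delta>: "0 \<le> \<delta>" "\<delta> \<le> 1" "8 * real n * \<delta>\<^sup>2 \<le> 1"
    and G: "(\<beta>1, \<tau>1, \<eta>, \<nu>) \<in> \<Theta>" "(\<beta>2, \<tau>2, \<eta>, \<nu>) \<in> \<Theta>"
    and L: "\<And>G. (\<lambda>T. L T G) \<in> borel_measurable borel" "\<And>T G. 0 \<le> L T G"
    and D: "0 \<le> D" "\<And>T. D \<le> L T (\<beta>1, \<tau>1, \<eta>, \<nu>) + L T (\<beta>2, \<tau>2, \<eta>, \<nu>)"
  shows "ennreal (D / 4) \<le> minimax_risk n \<Xi> \<Theta>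
    (\<lambda>G. data_dist n PX (cmoe_density gaussian_pdf h \<eta>0 \<nu>0 h G)) L"
  unfolding minimax_risk_def
proof (rule INF_greatest)
  interpret PX: prob_space PX by fact
  interpret pair_sigma_finite PX "lborel :: real measure" ..
  fix T assume "T \<in> estimators n \<Xi>"
  then have T: "T \<in> borel_measurable (PiM {..<n} (\<lambda>_. borel))"
    unfolding estimators_def by (rule measurable_restrict_space2_iff[THEN iffD1, THEN conjunct1])
  let ?G1 = "(\<beta>1, \<tau>1, \<eta>, \<nu>)" and ?G2 = "(\<beta>2, \<tau>2, \<eta>, \<nu>)"
  let ?p = "\<lambda>G (x, y). cmoe_density gaussian_pdf h \<eta>0 \<nu>0 h G x y"
  let ?P = "\<lambda>G. density (PX \<Otimes>\<^sub>M lborel) (?p G)"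
  let ?R = "\<lambda>G. \<integral>\<^sup>+ \<omega>. ennreal (L (T \<omega>) G) \<partial>data_dist n PX (cmoe_density gaussian_pdf h \<eta>0 \<nu>0 h G)"
  \<comment> \<open>The likelihood ratio of one observation at the second point against the first;
    its denominator never vanishes, since Gaussian densities are positive.\<close>
  define g where "g z = ?p ?G2 z / ?p ?G1 z" for z
  have pos: "0 < ?p (b, t, \<eta>, \<nu>) z" for b t z
    using cmoe_density_pos[OF \<nu>] by (auto split: prod.split)
  have p[measurable]: "?p G \<in> borel_measurable (PX \<Otimes>\<^sub>M lborel)" for G
    by (rule measurable_cmoe_density[OF PX h])
  have g[measurable]: "g \<in> borel_measurable (PX \<Otimes>\<^sub>M lborel)"
    unfolding g_def by measurable
  have P: "?P G = density (PX \<Otimes>\<^sub>M lborel) (\<lambda>(x, y). ennreal (cmoe_density gaussian_pdf h \<eta>0 \<nu>0 h G x y))" for G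
    by (simp add: split_beta')
  have g0: "0 \<le> g z" for z
    using pos[of \<beta>1 \<tau>1 z] pos[of \<beta>2 \<tau>2 z] unfolding g_def by (intro divide_nonneg_nonneg) linarith+
  have "density (?P ?G1) g = density (PX \<Otimes>\<^sub>M lborel) (\<lambda>z. ennreal (?p ?G1 z) * ennreal (g z))"
    by (rule density_density_eq) measurable
  also have "(\<lambda>z. ennreal (?p ?G1 z) * ennreal (g z)) = (\<lambda>z. ennreal (?p ?G2 z))"
  proof
    fix z
    show "ennreal (?p ?G1 z) * ennreal (g z) = ennreal (?p ?G2 z)"
      using pos[of \<beta>1 \<tau>1 z] g0[of z] by (simp add: g_def flip: ennreal_mult)
  qed
  finally have P2: "density (?P ?G1) g = ?P ?G2" .
  have ratio: "AE z in PX \<Otimes>\<^sub>M lborel. (g z - 1)\<^sup>2 \<le> (2 * \<delta>)\<^sup>2"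
  proof (rule AE_mp)
    \<comment> \<open>The exceptional set of covariates is null for \<open>PX\<close>, so its
      cylinder is null for the product measure.\<close>
    show "AE z in PX \<Otimes>\<^sub>M lborel. \<bar>(\<beta>2 \<bullet> fst z + \<tau>2) - (\<beta>1 \<bullet> fst z + \<tau>1)\<bar> \<le> \<delta>"
    proof -
      obtain N where N: "{x \<in> space PX. \<not> \<bar>(\<beta>2 \<bullet> x + \<tau>2) - (\<beta>1 \<bullet> x + \<tau>1)\<bar> \<le> \<delta>} \<subseteq> N" "N \<in> null_sets PX"
        using close unfolding eventually_ae_filter by auto
      from N(2) have "N \<times> space lborel \<in> null_sets (PX \<Otimes>\<^sub>M lborel)"
        by (rule lborel.times_in_null_sets1) simp
      then show ?thesis
        by (rule AE_I') (use N(1) in \<open>auto simp: space_pair_measure\<close>)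
    qed
    show "AE z in PX \<Otimes>\<^sub>M lborel. \<bar>(\<beta>2 \<bullet> fst z + \<tau>2) - (\<beta>1 \<bullet> fst z + \<tau>1)\<bar> \<le> \<delta>
        \<longrightarrow> (g z - 1)\<^sup>2 \<le> (2 * \<delta>)\<^sup>2"
    proof (intro AE_I2 impI)
      fix z :: "(real ^ 'd) \<times> real"
      assume c: "\<bar>(\<beta>2 \<bullet> fst z + \<tau>2) - (\<beta>1 \<bullet> fst z + \<tau>1)\<bar> \<le> \<delta>"
      have "?p ?G2 z \<le> exp \<delta> * ?p ?G1 z" 
        using cmoe_density_ratio[OF \<nu> c] by (simp add: split_beta')
      then have "g z \<le> exp \<delta>"
        using pos[of \<beta>1 \<tau>1 z] by (simp add: g_def pos_divide_le_eq)
      \<comment> \<open>The ratio bound with the two points exchanged yields the lower bound on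
        \<open>g\<close>.\<close>
      moreover have "?p ?G1 z \<le> exp \<delta> * ?p ?G2 z"
        using cmoe_density_ratio[OF \<nu>, of \<beta>1 "fst z" \<tau>1 \<beta>2 \<tau>2] c
        by (simp add: split_beta' abs_minus_commute)
      then have "exp (- \<delta>) \<le> g z"
        using pos[of \<beta>1 \<tau>1 z] by (simp add: g_def pos_le_divide_eq exp_minus field_simps)
      \<comment> \<open>Since \<delta> \<le> 1, the quadratic term in exp \<delta> \<le> 1 +
        \<delta> + \<delta>^2 is absorbed by \<delta>.\<close>
      moreover have "exp \<delta> \<le> 1 + 2 * \<delta>"
        using exp_bound[OF \<delta>(1,2)] mult_left_mono[OF \<delta>(2,1)] by (simp add: power2_eq_square)
      moreover have "1 - \<delta> \<le> exp (- \<delta>)"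
        using exp_ge_add_one_self[of "- \<delta>"] by simp
      ultimately have "\<bar>g z - 1\<bar> \<le> \<bar>2 * \<delta>\<bar>"
        using \<delta>(1) by linarith
      then show "(g z - 1)\<^sup>2 \<le> (2 * \<delta>)\<^sup>2"
        by (simp only: abs_le_square_iff)
    qed
  qed
  \<comment> \<open>The sample space carries the product Borel sigma-algebra, so the loss of an
    estimator is measurable for the law of the data.\<close>
  have sets_P: "sets (PiM {..<n} (\<lambda>_. ?P ?G1)) = sets (PiM {..<n} (\<lambda>_. borel))"
    by (intro sets_PiM_cong refl)
      (simp add: borel_prod[symmetric] sets_pair_measure_cong[OF PX] cong: sets_pair_measure_cong)
  have LT: "(\<lambda>\<omega>. ennreal (L (T \<omega>) G)) \<in> borel_measurable (PiM {..<n} (\<lambda>_. ?P ?G1))" for G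
    using measurable_compose[OF T L(1)[of G]] by (simp add: measurable_cong_sets[OF sets_P])
  have "ennreal (D / 2) \<le> (\<integral>\<^sup>+ \<omega>. ennreal (L (T \<omega>) ?G1) \<partial>PiM {..<n} (\<lambda>_. ?P ?G1))
      + (\<integral>\<^sup>+ \<omega>. ennreal (L (T \<omega>) ?G2) \<partial>PiM {..<n} (\<lambda>_. density (?P ?G1) g))"
  proof (rule le_cam_iid[where K = "(2 * \<delta>)\<^sup>2"])
    show "prob_space (?P ?G1)" "prob_space (density (?P ?G1) g)"
      unfolding P2 unfolding P by (intro prob_space_cmoe prob PX h \<nu>)+
    show "g \<in> borel_measurable (?P ?G1)"
      using g by simp
    show "AE z in ?P ?G1. (g z - 1)\<^sup>2 \<le> (2 * \<delta>)\<^sup>2"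
      using ratio by (subst AE_density) auto
    \<comment> \<open>With K = 4 \<delta>^2 the requirement n K \<le> 1/2 reads 8 n \<delta>^2 \<le>
      1, the third condition on \<delta>.\<close>
    show "real n * (2 * \<delta>)\<^sup>2 \<le> 1 / 2"
      using \<delta>(3) by (simp add: power_mult_distrib)
    show "ennreal D \<le> ennreal (L (T \<omega>) ?G1) + ennreal (L (T \<omega>) ?G2)" for \<omega>
      using D(2)[of "T \<omega>"] L(2) by (simp add: ennreal_leI flip: ennreal_plus)
  qed (use LT D g0 in auto)
  also have "\<dots> = ?R ?G1 + ?R ?G2"
    unfolding P2 by (simp add: data_dist_def split_beta')
  also have "\<dots> \<le> (SUP G\<in>\<Theta>. ?R G) + (SUP G\<in>\<Theta>. ?R G)"
    by (intro add_mono SUP_upper G)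
  finally have "ennreal (D / 2) \<le> (SUP G\<in>\<Theta>. ?R G) + (SUP G\<in>\<Theta>. ?R G)" .
  moreover have "ennreal (D / 4) \<le> S" if "ennreal (D / 2) \<le> S + S" for S
    using that by (cases S) (auto simp flip: ennreal_plus simp: ennreal_le_iff2)
  ultimately show "ennreal (D / 4) \<le> (SUP G\<in>\<Theta>. ?R G)"
    by blast
qed

section \<open>The two losses\<close>

lemma borel_measurable_loss_tau: "(\<lambda>T. loss_tau \<eta>0 \<nu>0 T G) \<in> borel_measurable borel"
  unfolding loss_tau_def by (cases G)
    (auto simp: split_beta intro!: borel_measurable_continuous_onI continuous_intros)

lemma borel_measurable_loss_expert: "(\<lambda>T. loss_expert \<eta>0 \<nu>0 T G) \<in> borel_measurable borel"
  unfolding loss_expert_def by (cases G)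
    (auto simp: split_beta intro!: borel_measurable_continuous_onI continuous_intros)

lemma loss_tau_nonneg: "0 \<le> loss_tau \<eta>0 \<nu>0 T G"
  by (simp add: loss_tau_def split_beta)

lemma loss_expert_nonneg: "0 \<le> loss_expert \<eta>0 \<nu>0 T G"
  by (simp add: loss_expert_def split_beta)

text \<open>The triangle inequality combined with (x + y)^2 \<le> 2 (x^2 + y^2). It supplies the
  separation hypothesis \<open>D\<close> for squared losses: \<open>t\<close> cannot be close to
  both \<open>a\<close> and \<open>b\<close>.\<close>

lemma half_sq_norm_diff_le:
  fixes a b t :: "'a::real_normed_vector"
  shows "(norm (a - b))\<^sup>2 / 2 \<le> (norm (t - a))\<^sup>2 + (norm (t - b))\<^sup>2"
proof -
  have "norm (a - b) \<le> norm (t - a) + norm (t - b)"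
    using norm_triangle_ineq4[of "t - b" "t - a"] by simp
  from power_mono[OF this norm_ge_zero] have "(norm (a - b))\<^sup>2 \<le> (norm (t - a) + norm (t - b))\<^sup>2"
    .
  also have "\<dots> \<le> 2 * ((norm (t - a))\<^sup>2 + (norm (t - b))\<^sup>2)"
    using zero_le_power2[of "norm (t - a) - norm (t - b)"] by (simp add: power2_eq_square algebra_simps)
  finally show ?thesis by simp
qed

section \<open>Choice of the two points and the resulting rates\<close>

theorem theorem4:
  fixes \<X> :: "(real ^ 'd) set" and \<Y> :: "real set"
    and PX :: "(real ^ 'd) measure"
    and \<Xi> :: "('d::finite, 'q::finite) param set"
    and f0 :: "real \<Rightarrow> real \<Rightarrow> real \<Rightarrow> real"
    and h0 h :: "real ^ 'd \<Rightarrow> real ^ 'q \<Rightarrow> real"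
    and \<eta>0 :: "real ^ 'q" and \<nu>0 :: real
    and l :: "nat \<Rightarrow> real" and r :: real and N :: nat
  assumes "bounded \<X>"
    and "prob_space PX" and "sets PX = sets borel" and "AE x in PX. x \<in> \<X>"
    and "absolutely_continuous lborel PX"
    and "AE y in lborel. y \<in> \<Y>"
    and "compact \<Xi>" and "\<And>\<beta> \<tau> \<eta> \<nu>. (\<beta>, \<tau>, \<eta>, \<nu>) \<in> \<Xi> \<Longrightarrow> \<nu> > 0"
    and "\<And>\<eta>. (\<lambda>x. h x \<eta>) \<in> borel_measurable borel"
    and "AE x in PX. \<forall>\<eta>. (h x) differentiable (at \<eta>)"
    and "\<nu>0 > 0"
    and "\<exists>B. \<forall>x\<in>\<X>. \<forall>y\<in>\<Y>. f0 y (h0 x \<eta>0) \<nu>0 \<le> B"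
    and "\<exists>p>0. \<exists>C>0. AE y in lborel. y \<in> \<Y> \<longrightarrow>
           ereal (C * \<bar>y\<bar> powr p) \<le> ext_expectation PX (\<lambda>x. - ln (f0 y (h0 x \<eta>0) \<nu>0))"
    and "f0 = gaussian_pdf" and "h0 = h"
    and "0 < r" and "r < 1"
    and "1 \<le> N" and "interior (\<Inter>n\<in>{N..}. Xi_trunc \<Xi> (l n) n) \<noteq> {}"
  shows "(\<exists>c>0. \<forall>n\<ge>N. ennreal (c * real n powr (- 1 / r)) \<le>
            minimax_risk n \<Xi> (Xi_trunc \<Xi> (l n) n)
              (\<lambda>G. data_dist n PX (cmoe_density f0 h0 \<eta>0 \<nu>0 h G)) (loss_tau \<eta>0 \<nu>0))
       \<and> (\<exists>c>0. \<forall>n\<ge>N. ennreal (c * real n powr (- 1 / r)) \<le>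
            minimax_risk n \<Xi> (Xi_trunc \<Xi> (l n) n)
              (\<lambda>G. data_dist n PX (cmoe_density f0 h0 \<eta>0 \<nu>0 h G)) (loss_expert \<eta>0 \<nu>0))"
proof -
  let ?\<Theta> = "\<Inter>n\<in>{N..}. Xi_trunc \<Xi> (l n) n"
  \<comment> \<open>\<open>M\<close> is at least 1 so that dividing by it is legitimate and does not
    enlarge the perturbation of \<beta> below.\<close>
  obtain M where M: "1 \<le> M" "\<And>x. x \<in> \<X> \<Longrightarrow> norm x \<le> M"
  proof -
    obtain M where "\<And>x. x \<in> \<X> \<Longrightarrow> norm x \<le> M"
      using \<open>bounded \<X>\<close> unfolding bounded_iff by blast
    then show thesis
      using that[of "max 1 M"] by fastforce
  qed
  \<comment> \<open>One ball lies in all truncated sets with \<open>n \<ge> N\<close>. Its centre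
    and radius do not depend on \<open>n\<close>, hence neither will the constants in the
    bounds.\<close>
  obtain \<beta> \<tau> \<eta> \<nu>' e where e: "0 < e" "ball (\<beta>, \<tau>, \<eta>, \<nu>') e \<subseteq> ?\<Theta>"
  proof -
    obtain G where "G \<in> interior ?\<Theta>"
      using assms(19) by blast
    then obtain e where "0 < e" "ball G e \<subseteq> ?\<Theta>"
      unfolding mem_interior by blast
    then show thesis
      using that by (cases G) blast
  qed
  \<comment> \<open>Both losses carry a power of \<kappa> as weight. If the centre has variance
    \<open>\<nu>0\<close>, a shift by e/2 makes \<kappa> positive while staying inside the
    ball.\<close>
  define \<nu> where "\<nu> = (if \<nu>' = \<nu>0 then \<nu>' + e / 2 else \<nu>')"
  define \<kappa> where "\<kappa> = norm (\<eta> - \<eta>0, \<nu> - \<nu>0)"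
  \<comment> \<open>The bound e/4 leaves room for the shift of the variance, as e/4 + e/2 < e. The
    bound 1/4 gives \<delta> \<le> 1 and 8 n \<delta>^2 = 8 a^2 \<le> 1/2.\<close>
  define a where "a = min (e / 4) (1 / 4)"
  define \<delta> where "\<delta> n = a / sqrt (real n)" for n
  have "\<nu> \<noteq> \<nu>0" using \<open>0 < e\<close> by (auto simp: \<nu>_def)
  then have "0 < \<kappa>" by (simp add: \<kappa>_def zero_prod_def)
  have "0 < a" using \<open>0 < e\<close> by (simp add: a_def)
  have near: "(b, t, \<eta>, \<nu>) \<in> Xi_trunc \<Xi> (l n) n"
    if "norm (b - \<beta>) + \<bar>t - \<tau>\<bar> \<le> a" "N \<le> n" for b t n
  proof -
    have "dist (b, t, \<eta>, \<nu>) (\<beta>, \<tau>, \<eta>, \<nu>') = norm (b - \<beta>, t - \<tau>, 0::real^'q, \<nu> - \<nu>')"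
      by (simp add: dist_norm)
    also have "\<dots> \<le> norm (b - \<beta>) + (\<bar>t - \<tau>\<bar> + (0 + \<bar>\<nu> - \<nu>'\<bar>))"
      by (intro order_trans[OF norm_Pair_le] add_mono) auto
    also have "\<dots> < e"
      using that(1) \<open>0 < e\<close> by (auto simp: a_def \<nu>_def)
    finally show ?thesis
      using subsetD[OF e(2), of "(b, t, \<eta>, \<nu>)"] that(2) by (simp add: dist_commute)
  qed
  have "(\<beta>, \<tau>, \<eta>, \<nu>) \<in> \<Xi>"
    using near[of \<beta> \<tau> N] \<open>0 < a\<close> by (auto simp: Xi_trunc_def)
  then have \<nu>: "0 < \<nu>" by fact
  have \<delta>: "0 < \<delta> n" "\<delta> n \<le> a" "\<delta> n \<le> 1" "8 * real n * (\<delta> n)\<^sup>2 \<le> 1" if "N \<le> n" for n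
  proof -
    have n: "1 \<le> real n" using that \<open>1 \<le> N\<close> by simp
    then show "0 < \<delta> n" using \<open>0 < a\<close> by (simp add: \<delta>_def)
    show "\<delta> n \<le> a"
      using n \<open>0 < a\<close> by (simp add: \<delta>_def divide_le_eq)
    then show "\<delta> n \<le> 1" by (simp add: a_def)
    have "a\<^sup>2 \<le> (1 / 4)\<^sup>2"
      using \<open>0 < a\<close> by (intro power_mono) (auto simp: a_def)
    then show "8 * real n * (\<delta> n)\<^sup>2 \<le> 1"
      using n by (simp add: \<delta>_def power_divide)
  qed
  \<comment> \<open>Here \<delta>^2 = a^2 / n, and -1/r < -1 with n \<ge> 1 makes the claimed rate
    the smaller one.\<close>
  have rate: "a\<^sup>2 * real n powr (- 1 / r) \<le> (\<delta> n)\<^sup>2" if "N \<le> n" for n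
  proof -
    have n: "1 \<le> real n" using that \<open>1 \<le> N\<close> by simp
    have "real n powr (- 1 / r) \<le> real n powr - 1"
      using n \<open>0 < r\<close> \<open>r < 1\<close> by (intro powr_mono) (auto simp: field_simps)
    then have "a\<^sup>2 * real n powr (- 1 / r) \<le> a\<^sup>2 * real n powr - 1"
      by (intro mult_left_mono) auto
    also have "\<dots> = (\<delta> n)\<^sup>2"
      using n by (simp add: \<delta>_def power_divide powr_minus_divide)
    finally show ?thesis .
  qed
  let ?risk = "\<lambda>n. minimax_risk n \<Xi> (Xi_trunc \<Xi> (l n) n)
    (\<lambda>G. data_dist n PX (cmoe_density f0 h0 \<eta>0 \<nu>0 h G))"
  \<comment> \<open>It remains to separate the losses at the two points by
    \<open>D = C * (\<delta> n)\<^sup>2\<close>; the divisor 4 is the one from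
    \<open>minimax_risk_two_point\<close>.\<close>
  have concl: "\<exists>c>0. \<forall>n\<ge>N. ennreal (c * real n powr (- 1 / r)) \<le> ?risk n L"
    if "0 < C" and bound: "\<And>n. N \<le> n \<Longrightarrow> ennreal (C * (\<delta> n)\<^sup>2 / 4) \<le> ?risk n L" for C L
  proof (intro exI[of _ "C * a\<^sup>2 / 4"] conjI allI impI)
    show "0 < C * a\<^sup>2 / 4" using \<open>0 < C\<close> \<open>0 < a\<close> by simp
    fix n assume "N \<le> n"
    have "ennreal (C * a\<^sup>2 / 4 * real n powr (- 1 / r)) \<le> ennreal (C * (\<delta> n)\<^sup>2 / 4)"
      using mult_left_mono[OF rate[OF \<open>N \<le> n\<close>], of C] \<open>0 < C\<close> by (intro ennreal_leI) simp
    with bound[OF \<open>N \<le> n\<close>] show "ennreal (C * a\<^sup>2 / 4 * real n powr (- 1 / r)) \<le> ?risk n L"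
      by (rule order_trans[rotated])
  qed
  show ?thesis
  proof
    show "\<exists>c>0. \<forall>n\<ge>N. ennreal (c * real n powr (- 1 / r)) \<le> ?risk n (loss_tau \<eta>0 \<nu>0)"
    proof (rule concl)
      \<comment> \<open>First bound: only \<tau> moves, so the logit changes by exactly
        \<open>\<delta> n\<close> and the weight \<open>\<kappa> ^ 4\<close> is the same at both
        points. The factor 1/2 comes from \<open>half_sq_norm_diff_le\<close>.\<close>
      show "0 < \<kappa> ^ 4 * (exp \<tau>)\<^sup>2 / 2" using \<open>0 < \<kappa>\<close> by simp
      fix n assume n: "N \<le> n"
      show "ennreal (\<kappa> ^ 4 * (exp \<tau>)\<^sup>2 / 2 * (\<delta> n)\<^sup>2 / 4) \<le> ?risk n (loss_tau \<eta>0 \<nu>0)"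
        unfolding \<open>f0 = gaussian_pdf\<close> \<open>h0 = h\<close>
      proof (rule minimax_risk_two_point[where ?\<beta>1.0 = \<beta> and ?\<beta>2.0 = \<beta> and ?\<tau>1.0 = \<tau> and ?\<tau>2.0 = "\<tau> + \<delta> n"
            and \<delta> = "\<delta> n",
            OF \<open>prob_space PX\<close> \<open>sets PX = sets borel\<close> assms(9) \<open>0 < \<nu>0\<close> \<nu>])
        fix T :: "('d, 'q) param"
        obtain b t c v where T: "T = (b, t, c, v)" by (cases T)
        \<comment> \<open>Convexity of exp turns the shift of \<tau> into a gap of at least exp
          \<tau> times that shift.\<close>
        have "exp \<tau> * \<delta> n \<le> exp (\<tau> + \<delta> n) - exp \<tau>"
          using mult_left_mono[OF exp_ge_add_one_self[of "\<delta> n"], of "exp \<tau>"]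
          by (simp add: exp_add algebra_simps)
        then have "(exp \<tau> * \<delta> n)\<^sup>2 \<le> (norm (exp \<tau> - exp (\<tau> + \<delta> n)))\<^sup>2"
          using \<delta>(1)[OF n] by (intro power_mono) auto
        then have "(exp \<tau> * \<delta> n)\<^sup>2 / 2 \<le> \<bar>exp t - exp \<tau>\<bar>\<^sup>2 + \<bar>exp t - exp (\<tau> + \<delta> n)\<bar>\<^sup>2"
          using half_sq_norm_diff_le[of "exp \<tau>" "exp (\<tau> + \<delta> n)" "exp t"] unfolding real_norm_def by linarith
        from mult_left_mono[OF this, of "\<kappa> ^ 4"] \<open>0 < \<kappa>\<close>
        show "\<kappa> ^ 4 * (exp \<tau>)\<^sup>2 / 2 * (\<delta> n)\<^sup>2
            \<le> loss_tau \<eta>0 \<nu>0 T (\<beta>, \<tau>, \<eta>, \<nu>) + loss_tau \<eta>0 \<nu>0 T (\<beta>, \<tau> + \<delta> n, \<eta>, \<nu>)"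
          by (simp add: T loss_tau_def \<kappa>_def[symmetric] distrib_left power_mult_distrib mult.assoc)
        show "AE x in PX. \<bar>(\<beta> \<bullet> x + (\<tau> + \<delta> n)) - (\<beta> \<bullet> x + \<tau>)\<bar> \<le> \<delta> n"
          using \<delta>(1)[OF n] by simp
        show "(\<beta>, \<tau> + \<delta> n, \<eta>, \<nu>) \<in> Xi_trunc \<Xi> (l n) n"
          using \<delta>(1,2)[OF n] by (intro near n) simp
        show "(\<beta>, \<tau>, \<eta>, \<nu>) \<in> Xi_trunc \<Xi> (l n) n"
          using \<open>0 < a\<close> by (intro near n) simp
      qed (simp_all add: \<delta>[OF n] less_imp_le[OF \<delta>(1)[OF n]] borel_measurable_loss_tau loss_tau_nonneg)
    qed
    show "\<exists>c>0. \<forall>n\<ge>N. ennreal (c * real n powr (- 1 / r)) \<le> ?risk n (loss_expert \<eta>0 \<nu>0)"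
    proof (rule concl)
      \<comment> \<open>Second bound: only \<beta> moves, so exp \<tau> and \<kappa> agree at both
        points. The shift has length \<open>\<delta> n / M\<close>, whose square accounts for the
        \<open>M\<^sup>2\<close>.\<close>
      show "0 < (exp \<tau>)\<^sup>2 * \<kappa>\<^sup>2 / (2 * M\<^sup>2)" using \<open>0 < \<kappa>\<close> \<open>1 \<le> M\<close> by simp
      fix n assume n: "N \<le> n"
      \<comment> \<open>A multiple of an arbitrary coordinate vector. By Cauchy-Schwarz, its length
        \<open>\<delta> n / M\<close> keeps the change of the logit below \<open>\<delta> n\<close>
        on the bounded covariate set.\<close>
      define u :: "real ^ 'd" where "u = (\<delta> n / M) *\<^sub>R axis undefined 1"
      have u: "norm u = \<delta> n / M"
        using \<delta>(1)[OF n] \<open>1 \<le> M\<close> by (simp add: u_def norm_axis_1)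
      have "\<delta> n / M \<le> \<delta> n"
        using \<delta>(1)[OF n] \<open>1 \<le> M\<close> by (simp add: divide_le_eq)
      show "ennreal ((exp \<tau>)\<^sup>2 * \<kappa>\<^sup>2 / (2 * M\<^sup>2) * (\<delta> n)\<^sup>2 / 4) \<le> ?risk n (loss_expert \<eta>0 \<nu>0)"
        unfolding \<open>f0 = gaussian_pdf\<close> \<open>h0 = h\<close>
      proof (rule minimax_risk_two_point[where ?\<beta>1.0 = \<beta> and ?\<beta>2.0 = "\<beta> + u" and ?\<tau>1.0 = \<tau> and ?\<tau>2.0 = \<tau>
            and \<delta> = "\<delta> n",
            OF \<open>prob_space PX\<close> \<open>sets PX = sets borel\<close> assms(9) \<open>0 < \<nu>0\<close> \<nu>])
        show "AE x in PX. \<bar>((\<beta> + u) \<bullet> x + \<tau>) - (\<beta> \<bullet> x + \<tau>)\<bar> \<le> \<delta> n"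
          using \<open>AE x in PX. x \<in> \<X>\<close>
        proof eventually_elim
          case (elim x)
          have "\<bar>u \<bullet> x\<bar> \<le> norm u * norm x"
            by (rule Cauchy_Schwarz_ineq2)
          also have "\<dots> \<le> \<delta> n / M * M"
            unfolding u using M(2)[OF elim] \<delta>(1)[OF n] \<open>1 \<le> M\<close> by (intro mult_left_mono) auto
          finally show ?case
            using \<open>1 \<le> M\<close> by (simp add: inner_add_left)
        qed
        show "(\<beta> + u, \<tau>, \<eta>, \<nu>) \<in> Xi_trunc \<Xi> (l n) n"
          using \<open>\<delta> n / M \<le> \<delta> n\<close> \<delta>(2)[OF n] u by (intro near n) simp
        fix T :: "('d, 'q) param"
        obtain b t c v where T: "T = (b, t, c, v)" by (cases T)
        \<comment> \<open>The \<eta> and \<nu> components cancel, so the distance of the two triples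
          is the length of \<open>u\<close>.\<close>
        have "(norm ((\<beta>, \<eta>, \<nu>) - (\<beta> + u, \<eta>, \<nu>)))\<^sup>2 = (\<delta> n / M)\<^sup>2"
          by (simp add: u norm_Pair power_divide)
        then have "(\<delta> n / M)\<^sup>2 / 2
            \<le> (norm ((b, c, v) - (\<beta>, \<eta>, \<nu>)))\<^sup>2 + (norm ((b, c, v) - (\<beta> + u, \<eta>, \<nu>)))\<^sup>2"
          using half_sq_norm_diff_le[of "(\<beta>, \<eta>, \<nu>)" "(\<beta> + u, \<eta>, \<nu>)" "(b, c, v)"] by (simp only:)
        from mult_left_mono[OF this, of "(exp \<tau>)\<^sup>2 * \<kappa>\<^sup>2"]
        show "(exp \<tau>)\<^sup>2 * \<kappa>\<^sup>2 / (2 * M\<^sup>2) * (\<delta> n)\<^sup>2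
            \<le> loss_expert \<eta>0 \<nu>0 T (\<beta>, \<tau>, \<eta>, \<nu>) + loss_expert \<eta>0 \<nu>0 T (\<beta> + u, \<tau>, \<eta>, \<nu>)"
          by (simp add: T loss_expert_def \<kappa>_def[symmetric] distrib_left power_divide ac_simps)
        show "(\<beta>, \<tau>, \<eta>, \<nu>) \<in> Xi_trunc \<Xi> (l n) n"
          using \<open>0 < a\<close> by (intro near n) simp
      qed (simp_all add: \<delta>[OF n] less_imp_le[OF \<delta>(1)[OF n]] borel_measurable_loss_expert loss_expert_nonneg)
    qed
  qed
qed

end
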